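(* Let $G$ and $H$ be graphs. Then $G\cong_{\mathcal S_+}H$ if and only if the first level of the Lasserre hierarchy for graph isomorphism of $G$ and $H$ is feasible, i.e., there exist real numbers $y=(y_\emptyset,\ y_{(g,h)},\ y_{\{(g,h),(g',h')\}})$, indexed by the subsets of $V_G\times V_H$ of size at most two, such that $$M_1(y)\succeq 0,$$ $$\sum_{h\in V_H}y_{(g,h)}=1\ \ \forall g\in V_G,\qquad \sum_{g\in V_G}y_{(g,h)}=1\ \ \forall h\in V_H,$$ $$y_{\{(g,h),(g',h')\}}=0\ \text{ if } \mathrm{rel}(g,g')\neq\mathrm{rel}(h,h'),\qquad y_\emptyset=1.$$ Furthermore, $G\cong_{\mathcal{DNN}}H$ if and only if this system is feasible with the additional constraint that all the variables in $y$ are nonnegative.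
   Context: Graphs are finite, simple and undirected. For vertices $x,y$ of the same graph, $\mathrm{rel}(x,y)$ denotes their relationship: equal, adjacent, or distinct non-adjacent. $\mathcal S_+$ is the cone of (Hermitian) positive semidefinite matrices; $\mathcal{DNN}$ is the cone of positive semidefinite matrices with nonnegative real entries. For a cone $\mathcal K$, $G\cong_{\mathcal K}H$ means: there is a matrix $M\in\mathcal K$ with rows and columns indexed by $V_G\times V_H$ such that $\sum_{h,h'\in V_H}M_{gh,g'h'}=1$ for all $g,g'\in V_G$; $\sum_{g,g'\in V_G}M_{gh,g'h'}=1$ for all $h,h'\in V_H$; and $M_{gh,g'h'}=0$ whenever $\mathrm{rel}(g,g')\neq\mathrm{rel}(h,h')$. $M_1(y)$ is the symmetric matrix with rows and columns indexed by $\emptyset$ and the elements $(g,h)\in V_G\times V_H$ (viewed as singletons) whose $(S,T)$ entry is $y_{S\cup T}$. Thus its $(\emptyset,\emptyset)$ entry is $y_\emptyset$, its $(\emptyset,(g,h))$ and $((g,h),(g,h))$ entries are $y_{(g,h)}$, and its $((g,h),(g',h'))$ entry for distinct pairs is $y_{\{(g,h),(g',h')\}}$. *)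

theory Defs
  imports
    Complex_Main
    "HOL-Library.Nonpos_Ints"
    "Graph_Theory.Pair_Digraph"
begin

text \<open>
  Finite simple undirected graphs are modelled by the locale predicate \<^term>\<open>pair_graph\<close>: finite
  vertex set \<^term>\<open>pverts G\<close> and a symmetric, irreflexive arc relation \<^term>\<open>parcs G\<close> on it, each
  undirected edge being the two arcs between its ends.
\<close>

datatype relationship = Equal | Adjacent | Distinct_Nonadjacent

definition rel :: "'a pair_pre_digraph \<Rightarrow> 'a \<Rightarrow> 'a \<Rightarrow> relationship" where
  "rel G x y =
     (if x = y then Equal
      else if (x, y) \<in> parcs G then Adjacent
      else Distinct_Nonadjacent)"

text \<open>
  A matrix with rows and columns indexed by a finite set \<open>I\<close> is a function \<open>M :: 'i \<Rightarrow> 'i \<Rightarrow> complex\<close>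
  of which only the entries with both indices in \<open>I\<close> are relevant. A family of cones of
  matrices, such as the following two, is a function of the index set.
\<close>

definition psd_cone :: "'i set \<Rightarrow> ('i \<Rightarrow> 'i \<Rightarrow> complex) set" where
  "psd_cone I =
     {M. (\<forall>i\<in>I. \<forall>j\<in>I. M j i = cnj (M i j)) \<and>
         (\<forall>v :: 'i \<Rightarrow> complex. (\<Sum>i\<in>I. \<Sum>j\<in>I. cnj (v i) * M i j * v j) \<in> \<real>\<^sub>\<ge>\<^sub>0)}"

definition dnn_cone :: "'i set \<Rightarrow> ('i \<Rightarrow> 'i \<Rightarrow> complex) set" where
  "dnn_cone I = {M \<in> psd_cone I. \<forall>i\<in>I. \<forall>j\<in>I. M i j \<in> \<real>\<^sub>\<ge>\<^sub>0}"

definition cone_isomorphic ::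
  "(('a \<times> 'b) set \<Rightarrow> ('a \<times> 'b \<Rightarrow> 'a \<times> 'b \<Rightarrow> complex) set) \<Rightarrow>
   'a pair_pre_digraph \<Rightarrow> 'b pair_pre_digraph \<Rightarrow> bool" where
  "cone_isomorphic K G H \<longleftrightarrow>
     (\<exists>M \<in> K (pverts G \<times> pverts H).
        (\<forall>g\<in>pverts G. \<forall>g'\<in>pverts G. (\<Sum>h\<in>pverts H. \<Sum>h'\<in>pverts H. M (g, h) (g', h')) = 1) \<and>
        (\<forall>h\<in>pverts H. \<forall>h'\<in>pverts H. (\<Sum>g\<in>pverts G. \<Sum>g'\<in>pverts G. M (g, h) (g', h')) = 1) \<and>
        (\<forall>g\<in>pverts G. \<forall>g'\<in>pverts G. \<forall>h\<in>pverts H. \<forall>h'\<in>pverts H.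
           rel G g g' \<noteq> rel H h h' \<longrightarrow> M (g, h) (g', h') = 0))"

text \<open>
  The variables of the first Lasserre level are a function \<open>y\<close> on sets, of which only the values at
  the subsets of \<open>V\<^sub>G \<times> V\<^sub>H\<close> with at most two elements are relevant. The variable of a pair
  \<open>(g, h)\<close> is \<open>y {(g, h)}\<close>.
\<close>

definition moment_index :: "'a pair_pre_digraph \<Rightarrow> 'b pair_pre_digraph \<Rightarrow> ('a \<times> 'b) set set" where
  "moment_index G H = {S. S \<subseteq> pverts G \<times> pverts H \<and> card S \<le> 1}"

definition moment_matrix :: "('c set \<Rightarrow> real) \<Rightarrow> 'c set \<Rightarrow> 'c set \<Rightarrow> real" where
  "moment_matrix y S T = y (S \<union> T)"

definition lasserre1 ::
  "'a pair_pre_digraph \<Rightarrow> 'b pair_pre_digraph \<Rightarrow> (('a \<times> 'b) set \<Rightarrow> real) \<Rightarrow> bool" where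
  "lasserre1 G H y \<longleftrightarrow>
     (\<lambda>S T. complex_of_real (moment_matrix y S T)) \<in> psd_cone (moment_index G H) \<and>
     (\<forall>g\<in>pverts G. (\<Sum>h\<in>pverts H. y {(g, h)}) = 1) \<and>
     (\<forall>h\<in>pverts H. (\<Sum>g\<in>pverts G. y {(g, h)}) = 1) \<and>
     (\<forall>g\<in>pverts G. \<forall>g'\<in>pverts G. \<forall>h\<in>pverts H. \<forall>h'\<in>pverts H.
        rel G g g' \<noteq> rel H h h' \<longrightarrow> y {(g, h), (g', h')} = 0) \<and>
     y {} = 1"

definition nonneg_variables ::
  "'a pair_pre_digraph \<Rightarrow> 'b pair_pre_digraph \<Rightarrow> (('a \<times> 'b) set \<Rightarrow> real) \<Rightarrow> bool" where
  "nonneg_variables G H y \<longleftrightarrow>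
     (\<forall>S. S \<subseteq> pverts G \<times> pverts H \<and> card S \<le> 2 \<longrightarrow> 0 \<le> y S)"

end

theory Submission
  imports Defs
begin

text \<open>
  Think of a positive semidefinite \<open>M\<close> as the Gram matrix of vectors \<open>u\<^sub>g\<^sub>h\<close>. The row sum
  condition says that the vectors \<open>w\<^sub>g = \<Sum>\<^sub>h u\<^sub>g\<^sub>h\<close> have all mutual inner products \<open>1\<close>, so they are
  one unit vector \<open>w\<close>; as \<open>u\<^sub>g\<^sub>h\<close> is orthogonal to the other \<open>u\<^sub>g\<^sub>h\<^sub>'\<close> of its row, its inner product
  with \<open>w\<close> is its squared norm. Hence \<open>w\<close> together with the \<open>u\<^sub>g\<^sub>h\<close> realises the moment matrix.
  Conversely, in a Gram realisation of the moment matrix the vector of \<open>{}\<close> minus a row sum or a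
  column sum has norm \<open>0\<close>, so that all these sums are the same unit vector. No factorisation is
  needed: a vanishing combination of Gram vectors is an isotropic vector of the quadratic form, and
  such a vector lies in the kernel of the matrix.
\<close>

section \<open>Real quadratic forms and isotropic vectors\<close>

definition bilin :: "'i set \<Rightarrow> ('i \<Rightarrow> 'i \<Rightarrow> real) \<Rightarrow> ('i \<Rightarrow> real) \<Rightarrow> ('i \<Rightarrow> real) \<Rightarrow> real" where
  "bilin I A x z = (\<Sum>i\<in>I. \<Sum>j\<in>I. x i * A i j * z j)"

text \<open>Only real vectors are tested. For a real symmetric matrix this gives complex positive
  semidefiniteness too, as \<open>of_real_psd_cone_iff\<close> shows.\<close>

definition real_psd :: "'i set \<Rightarrow> ('i \<Rightarrow> 'i \<Rightarrow> real) \<Rightarrow> bool" where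
  "real_psd I A \<longleftrightarrow> (\<forall>i\<in>I. \<forall>j\<in>I. A j i = A i j) \<and> (\<forall>v. 0 \<le> bilin I A v v)"

lemma bilin_commute:
  assumes "\<And>i j. i \<in> I \<Longrightarrow> j \<in> I \<Longrightarrow> A j i = A i j"
  shows "bilin I A x z = bilin I A z x"
proof -
  have "bilin I A x z = (\<Sum>j\<in>I. \<Sum>i\<in>I. x i * A i j * z j)"
    unfolding bilin_def by (rule sum.swap)
  also have "\<dots> = bilin I A z x"
    unfolding bilin_def using assms by (intro sum.cong refl) (simp add: mult_ac)
  finally show ?thesis .
qed

lemma bilin_add_square:
  assumes "\<And>i j. i \<in> I \<Longrightarrow> j \<in> I \<Longrightarrow> A j i = A i j"
  shows "bilin I A (\<lambda>i. x i + c * z i) (\<lambda>i. x i + c * z i) =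
    bilin I A x x + 2 * c * bilin I A x z + c\<^sup>2 * bilin I A z z"
proof -
  have "bilin I A (\<lambda>i. x i + c * z i) (\<lambda>i. x i + c * z i) =
    bilin I A x x + c * bilin I A x z + c * bilin I A z x + c\<^sup>2 * bilin I A z z"
    unfolding bilin_def
    by (simp add: sum.distrib[symmetric] sum_distrib_left algebra_simps power2_eq_square)
  then show ?thesis
    using bilin_commute[of I A x z] assms by simp
qed

text \<open>The indicator of \<open>P\<close> stands for the sum of the Gram vectors over
  \<open>P\<close>; this and the next two lemmas compute inner products with such block
  sums.\<close>

lemma bilin_of_bool_right:
  assumes "finite I" "P \<subseteq> I"
  shows "bilin I A x (\<lambda>i. of_bool (i \<in> P)) = (\<Sum>i\<in>I. x i * (\<Sum>p\<in>P. A i p))"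
  unfolding bilin_def using assms by (simp add: Int_absorb1 sum_distrib_left)

lemma bilin_of_bool_left:
  assumes "finite I" "P \<subseteq> I"
  shows "bilin I A (\<lambda>i. of_bool (i \<in> P)) z = (\<Sum>p\<in>P. \<Sum>j\<in>I. A p j * z j)"
  unfolding bilin_def using assms
  by (simp add: Int_absorb1 sum_distrib_left[symmetric] mult.assoc)

lemma bilin_of_bool_of_bool:
  assumes "finite I" "P \<subseteq> I" "Q \<subseteq> I"
  shows "bilin I A (\<lambda>i. of_bool (i \<in> P)) (\<lambda>i. of_bool (i \<in> Q)) = (\<Sum>p\<in>P. \<Sum>q\<in>Q. A p q)"
  using assms by (simp add: bilin_of_bool_left Int_absorb1)

lemma affine_nonneg_imp_slope_zero:
  fixes a b :: real
  assumes "\<And>t. 0 \<le> a + t * b"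
  shows "b = 0"
proof (rule ccontr)
  assume "b \<noteq> 0"
  then show False
    \<comment> \<open>This \<open>t\<close> gives the affine function the value
      \<open>- 1\<close>.\<close>
    using assms[of "- (a + 1) / b"] by simp
qed

text \<open>Move from the \<open>i\<close>-th unit vector in direction \<open>x\<close>. Isotropy
  removes the quadratic term, so the form is affine in the parameter \<open>t\<close> and
  nonnegative for every \<open>t\<close>; its slope, twice the \<open>i\<close>-th entry of the
  product of \<open>A\<close> and \<open>x\<close>, must vanish.\<close>

lemma isotropic_imp_kernel:
  assumes fin: "finite I" and psd: "real_psd I A" and iso: "bilin I A x x = 0" and i: "i \<in> I"
  shows "(\<Sum>j\<in>I. A i j * x j) = 0"
proof -
  let ?e = "\<lambda>k. of_bool (k \<in> {i}) :: real"
  have sym: "\<And>i j. i \<in> I \<Longrightarrow> j \<in> I \<Longrightarrow> A j i = A i j"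
    using psd by (auto simp: real_psd_def)
  have ge: "0 \<le> bilin I A ?e ?e + t * (2 * bilin I A ?e x)" for t
  proof -
    have "0 \<le> bilin I A (\<lambda>k. ?e k + t * x k) (\<lambda>k. ?e k + t * x k)"
      using psd unfolding real_psd_def by blast
    also have "\<dots> = bilin I A ?e ?e + 2 * t * bilin I A ?e x + t\<^sup>2 * bilin I A x x"
      by (rule bilin_add_square[OF sym])
    finally show ?thesis
      using iso by (simp add: mult_ac)
  qed
  have "2 * bilin I A ?e x = 0"
    by (rule affine_nonneg_imp_slope_zero) (rule ge)
  moreover have "bilin I A ?e x = (\<Sum>j\<in>I. A i j * x j)"
    using bilin_of_bool_left[OF fin, of "{i}" A x] i by simp
  ultimately show ?thesis by simp
qed

section \<open>Complex versus real positive semidefiniteness\<close>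

lemma nonneg_Reals_Re: "z \<in> \<real>\<^sub>\<ge>\<^sub>0 \<Longrightarrow> 0 \<le> Re z"
  by (elim nonneg_Reals_cases) simp

text \<open>On a real vector, the real part of the complex form is the form of the real parts. Since
  the remaining constraints are real and linear, a complex \<open>M\<close> may thus be replaced by
  its real part.\<close>

lemma real_psd_Re:
  assumes "M \<in> psd_cone I"
  shows "real_psd I (\<lambda>i j. Re (M i j))"
proof -
  have "0 \<le> bilin I (\<lambda>i j. Re (M i j)) v v" for v
  proof -
    have "(\<Sum>i\<in>I. \<Sum>j\<in>I. cnj (of_real (v i)) * M i j * of_real (v j)) \<in> \<real>\<^sub>\<ge>\<^sub>0"
      using assms unfolding psd_cone_def mem_Collect_eq
      by (elim conjE allE[of _ "\<lambda>i. complex_of_real (v i)"])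
    then have "0 \<le> Re (\<Sum>i\<in>I. \<Sum>j\<in>I. cnj (of_real (v i)) * M i j * of_real (v j))"
      by (rule nonneg_Reals_Re)
    then show ?thesis
      by (simp add: bilin_def)
  qed
  moreover have "\<forall>i\<in>I. \<forall>j\<in>I. Re (M j i) = Re (M i j)"
  proof (intro ballI)
    fix i j assume "i \<in> I" "j \<in> I"
    then have "M j i = cnj (M i j)"
      using assms unfolding psd_cone_def by blast
    then show "Re (M j i) = Re (M i j)"
      by (metis cnj.simps(1))
  qed
  ultimately show ?thesis
    by (simp add: real_psd_def)
qed

text \<open>Splitting a complex vector into real and imaginary parts, the form is the sum of its
  values at both parts; the cross terms cancel by symmetry.\<close>

lemma of_real_psd_cone_iff:
  "(\<lambda>i j. complex_of_real (A i j)) \<in> psd_cone I \<longleftrightarrow> real_psd I A"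
proof
  assume "(\<lambda>i j. complex_of_real (A i j)) \<in> psd_cone I"
  from real_psd_Re[OF this] show "real_psd I A" by simp
next
  assume psd: "real_psd I A"
  have "(\<Sum>i\<in>I. \<Sum>j\<in>I. cnj (v i) * of_real (A i j) * v j) \<in> \<real>\<^sub>\<ge>\<^sub>0" (is "?z \<in> _") for v
  proof -
    let ?a = "\<lambda>i. Re (v i)" and ?b = "\<lambda>i. Im (v i)"
    have "Re ?z = bilin I A ?a ?a + bilin I A ?b ?b"
      by (simp add: bilin_def sum.distrib[symmetric] algebra_simps)
    moreover have "Im ?z = bilin I A ?a ?b - bilin I A ?b ?a"
      by (simp add: bilin_def sum_subtractf[symmetric] algebra_simps)
    moreover have "bilin I A ?a ?b = bilin I A ?b ?a"
      using psd by (intro bilin_commute) (auto simp: real_psd_def)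
    ultimately have "?z = of_real (bilin I A ?a ?a + bilin I A ?b ?b)"
      by (simp add: complex_eq_iff)
    moreover have "0 \<le> bilin I A ?a ?a" "0 \<le> bilin I A ?b ?b"
      using psd by (auto simp: real_psd_def)
    ultimately show ?thesis
      by (simp only: nonneg_Reals_of_real_iff add_nonneg_nonneg)
  qed
  with psd show "(\<lambda>i j. complex_of_real (A i j)) \<in> psd_cone I"
    by (auto simp: psd_cone_def real_psd_def)
qed

section \<open>Sums of Gram vectors over blocks\<close>

text \<open>In Gram terms, a member of an orthogonal family has its squared norm as inner product
  with the sum of the family.\<close>

lemma sum_orthogonal_block:
  fixes A :: "'i \<Rightarrow> 'i \<Rightarrow> real"
  assumes "finite P" "\<And>p q. p \<in> P \<Longrightarrow> q \<in> P \<Longrightarrow> p \<noteq> q \<Longrightarrow> A p q = 0" "p \<in> P"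
  shows "(\<Sum>q\<in>P. A p q) = A p p"
proof -
  have "(\<Sum>q\<in>P. A p q) = (\<Sum>q\<in>P. if q = p then A p p else 0)"
    using assms by (intro sum.cong) auto
  with assms show ?thesis by simp
qed

text \<open>The difference of the two block sums has squared norm 1 - 2 + 1 = 0, so its indicator
  combination is isotropic and lies in the kernel.\<close>

lemma block_sums_eq:
  assumes fin: "finite I" and psd: "real_psd I A" and sub: "P \<subseteq> I" "Q \<subseteq> I"
    and one: "(\<Sum>p\<in>P. \<Sum>q\<in>P. A p q) = 1" "(\<Sum>p\<in>P. \<Sum>q\<in>Q. A p q) = 1"
      "(\<Sum>p\<in>Q. \<Sum>q\<in>Q. A p q) = 1"
    and i: "i \<in> I"
  shows "(\<Sum>p\<in>P. A i p) = (\<Sum>q\<in>Q. A i q)"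
proof -
  let ?x = "\<lambda>i. of_bool (i \<in> P) + (- 1) * of_bool (i \<in> Q) :: real"
  have "bilin I A ?x ?x = 0"
    by (subst bilin_add_square)
      (use psd in \<open>auto simp: real_psd_def bilin_of_bool_of_bool fin sub one\<close>)
  from isotropic_imp_kernel[OF fin psd this i]
  have "(\<Sum>j\<in>I. A i j * of_bool (j \<in> P)) - (\<Sum>j\<in>I. A i j * of_bool (j \<in> Q)) = 0"
    by (simp add: sum_subtractf[symmetric] algebra_simps)
  then show ?thesis
    by (simp add: Int_absorb1 fin sub)
qed

text \<open>The right side is the form at \<open>v\<close> plus \<open>a\<close> times the indicator
  of \<open>P\<close>. It is the form of \<open>A\<close> bordered by one further Gram vector, the
  unit vector summing the block \<open>P\<close>.\<close>

lemma bordered_form_nonneg: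
  assumes fin: "finite I" and psd: "real_psd I A" and sub: "P \<subseteq> I"
    and one: "(\<Sum>p\<in>P. \<Sum>q\<in>P. A p q) = 1"
  shows "0 \<le> a\<^sup>2 + 2 * a * (\<Sum>i\<in>I. v i * (\<Sum>p\<in>P. A i p)) + bilin I A v v"
proof -
  let ?w = "\<lambda>i. of_bool (i \<in> P) :: real"
  have "0 \<le> bilin I A (\<lambda>i. v i + a * ?w i) (\<lambda>i. v i + a * ?w i)"
    using psd unfolding real_psd_def by blast
  also have "\<dots> = bilin I A v v + 2 * a * bilin I A v ?w + a\<^sup>2 * bilin I A ?w ?w"
    using psd by (intro bilin_add_square) (auto simp: real_psd_def)
  finally show ?thesis
    by (simp add: bilin_of_bool_of_bool bilin_of_bool_right fin sub one add_ac)
qed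

section \<open>The quadratic form of the moment matrix\<close>

text \<open>Finiteness matters because \<open>card\<close> is 0 on infinite sets, which would
  otherwise pass the bound on the cardinality.\<close>

lemma moment_index_eq:
  "finite (pverts G \<times> pverts H) \<Longrightarrow>
   moment_index G H = insert {} ((\<lambda>p. {p}) ` (pverts G \<times> pverts H))"
proof (intro set_eqI iffI)
  fix S assume fin: "finite (pverts G \<times> pverts H)" and "S \<in> moment_index G H"
  then have S: "S \<subseteq> pverts G \<times> pverts H" "card S \<le> 1" "finite S"
    by (simp_all add: moment_index_def finite_subset[OF _ fin])
  then have "card S = 0 \<or> card S = 1" by linarith
  with S show "S \<in> insert {} ((\<lambda>p. {p}) ` (pverts G \<times> pverts H))"
    by (auto simp del: One_nat_def elim!: card_1_singletonE)
qed (auto simp: moment_index_def)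

lemma sum_moment_index:
  fixes f :: "('a \<times> 'b) set \<Rightarrow> real"
  assumes "finite (pverts G \<times> pverts H)"
  shows "sum f (moment_index G H) = f {} + (\<Sum>p\<in>pverts G \<times> pverts H. f {p})"
proof -
  have "sum f ((\<lambda>p. {p}) ` (pverts G \<times> pverts H)) = (\<Sum>p\<in>pverts G \<times> pverts H. f {p})"
    by (subst sum.reindex) auto
  moreover have "{} \<notin> (\<lambda>p. {p}) ` (pverts G \<times> pverts H)" by auto
  ultimately show ?thesis
    using assms by (simp only: moment_index_eq sum.insert finite_imageI not_False_eq_True)
qed

text \<open>Separating the index \<open>{}\<close> exhibits the moment form as a bordered form, with
  border entries \<open>y {p}\<close>, ready for comparison with
  \<open>bordered_form_nonneg\<close>.\<close>

lemma bilin_moment_index: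
  fixes y :: "('a \<times> 'b) set \<Rightarrow> real"
  assumes fin: "finite (pverts G \<times> pverts H)"
  shows "bilin (moment_index G H) (moment_matrix y) v v =
    (v {})\<^sup>2 * y {} + 2 * v {} * (\<Sum>p\<in>pverts G \<times> pverts H. v {p} * y {p})
    + bilin (pverts G \<times> pverts H) (\<lambda>p q. y {p, q}) (\<lambda>p. v {p}) (\<lambda>p. v {p})"
proof -
  let ?V = "pverts G \<times> pverts H"
  have "(\<Sum>p\<in>?V. v {} * y {p} * v {p}) = v {} * (\<Sum>p\<in>?V. v {p} * y {p})"
    and "(\<Sum>p\<in>?V. v {p} * y {p} * v {}) = v {} * (\<Sum>p\<in>?V. v {p} * y {p})"
    unfolding sum_distrib_left by (auto intro: sum.cong)
  moreover have "{p} \<union> {q} = {p, q}" for p q :: "'a \<times> 'b" by auto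
  ultimately show ?thesis
    unfolding bilin_def sum_moment_index[OF fin] moment_matrix_def
    by (simp only: Un_empty_left Un_empty_right sum.distrib) (simp add: power2_eq_square)
qed

text \<open>The Gram vector of \<open>{}\<close> minus the block sum over \<open>P\<close> has
  squared norm 1 - 2 + 1 = 0. Row \<open>{q}\<close> of the resulting kernel relation is the
  claim.\<close>

lemma moment_block_sum:
  fixes y :: "('a \<times> 'b) set \<Rightarrow> real"
  assumes fin: "finite (pverts G \<times> pverts H)"
    and psd: "real_psd (moment_index G H) (moment_matrix y)" and y0: "y {} = 1"
    and sub: "P \<subseteq> pverts G \<times> pverts H" and one: "(\<Sum>p\<in>P. y {p}) = 1"
    and orth: "\<And>p q. p \<in> P \<Longrightarrow> q \<in> P \<Longrightarrow> p \<noteq> q \<Longrightarrow> y {p, q} = 0"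
    and q: "q \<in> pverts G \<times> pverts H"
  shows "(\<Sum>p\<in>P. y {p, q}) = y {q}"
proof -
  let ?V = "pverts G \<times> pverts H"
  let ?x = "\<lambda>S. if S = {} then 1 else - of_bool (S \<in> (\<lambda>p. {p}) ` P) :: real"
  have xs: "?x {p} = - of_bool (p \<in> P)" for p by auto
  \<comment> \<open>Orthogonality reduces the squared norm of the block sum to the sum of the
    diagonal entries \<open>y {p}\<close>.\<close>
  have block: "(\<Sum>p\<in>P. \<Sum>q\<in>P. y {p, q}) = 1"
  proof -
    have "(\<Sum>q\<in>P. y {p, q}) = y {p}" if "p \<in> P" for p
      using sum_orthogonal_block[of P "\<lambda>p q. y {p, q}" p] finite_subset[OF sub fin] orth that
      by simp
    with one show ?thesis by simp
  qed
  have "bilin ?V (\<lambda>p q. y {p, q}) (\<lambda>p. ?x {p}) (\<lambda>p. ?x {p}) =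
      bilin ?V (\<lambda>p q. y {p, q}) (\<lambda>p. of_bool (p \<in> P)) (\<lambda>p. of_bool (p \<in> P))"
    unfolding bilin_def xs by simp
  moreover have "(\<Sum>p\<in>?V. ?x {p} * y {p}) = - 1"
    unfolding xs using one by (simp add: sum_negf Int_absorb1[OF sub] fin)
  ultimately have "bilin (moment_index G H) (moment_matrix y) ?x ?x = 0"
    unfolding bilin_moment_index[OF fin]
    by (simp add: bilin_of_bool_of_bool[OF fin sub sub] block y0)
  moreover have "finite (moment_index G H)" "{q} \<in> moment_index G H"
    using fin q by (auto simp: moment_index_eq)
  ultimately have "(\<Sum>T\<in>moment_index G H. moment_matrix y {q} T * ?x T) = 0"
    using psd by (intro isotropic_imp_kernel)
  then have "y {q} - (\<Sum>p\<in>?V. y {p, q} * of_bool (p \<in> P)) = 0"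
    unfolding sum_moment_index[OF fin] xs
    by (simp add: moment_matrix_def sum_negf)
  then show ?thesis
    by (simp add: Int_absorb1[OF sub] fin)
qed

section \<open>Passing between cone matrices and moment variables\<close>

text \<open>An unordered pair is given an arbitrary order by choice, and symmetry makes the entry
  independent of it. Singletons are covered as \<open>{i, i}\<close>.\<close>

lemma pair_function_exists:
  fixes A :: "'i \<Rightarrow> 'i \<Rightarrow> real"
  assumes sym: "\<And>i j. i \<in> I \<Longrightarrow> j \<in> I \<Longrightarrow> A j i = A i j"
  obtains y where "y {} = 1" "\<And>i j. i \<in> I \<Longrightarrow> j \<in> I \<Longrightarrow> y {i, j} = A i j"
proof -
  let ?z = "\<lambda>S. SOME z. S = {fst z, snd z}"
  let ?y = "\<lambda>S. if S = {} then 1 else A (fst (?z S)) (snd (?z S))"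
  have "?y {i, j} = A i j" if ij: "i \<in> I" "j \<in> I" for i j
  proof -
    have "{i, j} = {fst (?z {i, j}), snd (?z {i, j})}"
      by (rule someI[of _ "(i, j)"]) simp
    then have "fst (?z {i, j}) = i \<and> snd (?z {i, j}) = j \<or> fst (?z {i, j}) = j \<and> snd (?z {i, j}) = i"
      by (auto simp: doubleton_eq_iff)
    then show ?thesis
      using sym[OF ij] by auto
  qed
  then show thesis
    by (intro that[of ?y]) simp_all
qed

text \<open>The border of the moment matrix is realised by the common row sum vector, taken from one
  fixed row.\<close>

lemma cone_matrix_imp_lasserre1:
  fixes G :: "'a pair_pre_digraph" and H :: "'b pair_pre_digraph"
    and A :: "'a \<times> 'b \<Rightarrow> 'a \<times> 'b \<Rightarrow> real"
  defines "V \<equiv> pverts G \<times> pverts H"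
  assumes fin: "finite (pverts G)" "finite (pverts H)"
    and psd: "real_psd V A"
    and row: "\<And>g g'. g \<in> pverts G \<Longrightarrow> g' \<in> pverts G \<Longrightarrow>
      (\<Sum>h\<in>pverts H. \<Sum>h'\<in>pverts H. A (g, h) (g', h')) = 1"
    and col: "\<And>h h'. h \<in> pverts H \<Longrightarrow> h' \<in> pverts H \<Longrightarrow>
      (\<Sum>g\<in>pverts G. \<Sum>g'\<in>pverts G. A (g, h) (g', h')) = 1"
    and zero: "\<And>g g' h h'. g \<in> pverts G \<Longrightarrow> g' \<in> pverts G \<Longrightarrow> h \<in> pverts H \<Longrightarrow> h' \<in> pverts H \<Longrightarrow>
      rel G g g' \<noteq> rel H h h' \<Longrightarrow> A (g, h) (g', h') = 0"
    and y0: "y {} = 1" and y: "\<And>p q. p \<in> V \<Longrightarrow> q \<in> V \<Longrightarrow> y {p, q} = A p q"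
  shows "lasserre1 G H y"
proof -
  have finV: "finite V" using fin by (simp add: V_def)
  have y1: "y {p} = A p p" if "p \<in> V" for p
    using y[OF that that] by simp
  \<comment> \<open>Two pairs with the same \<open>g\<close> but different second components have
    relationship \<open>Equal\<close> on one side only, so their entry vanishes.\<close>
  have diag_row: "(\<Sum>h'\<in>pverts H. A (g, h) (g, h')) = A (g, h) (g, h)"
    if "g \<in> pverts G" "h \<in> pverts H" for g h
    using that fin by (intro sum_orthogonal_block[where A = "\<lambda>h h'. A (g, h) (g, h')"])
      (auto intro!: zero simp: rel_def split: if_splits)
  have diag_col: "(\<Sum>g'\<in>pverts G. A (g, h) (g', h)) = A (g, h) (g, h)"
    if "g \<in> pverts G" "h \<in> pverts H" for g h
    using that fin by (intro sum_orthogonal_block[where A = "\<lambda>g g'. A (g, h) (g', h)"])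
      (auto intro!: zero simp: rel_def split: if_splits)
  have yrow: "(\<Sum>h\<in>pverts H. y {(g, h)}) = 1" if "g \<in> pverts G" for g
    using row[OF that that] that by (simp add: diag_row y1 V_def)
  have ycol: "(\<Sum>g\<in>pverts G. y {(g, h)}) = 1" if "h \<in> pverts H" for h
    using col[OF that that] that by (simp add: diag_col y1 V_def)
  have form: "bilin V (\<lambda>p q. y {p, q}) u u = bilin V A u u" for u
    unfolding bilin_def by (intro sum.cong refl) (simp add: y)
  have "0 \<le> bilin (moment_index G H) (moment_matrix y) v v" for v
  proof (cases "V = {}")
    \<comment> \<open>No row is available to provide the unit vector here; the form is just the
      square of \<open>v {}\<close>.\<close>
    case True
    then show ?thesis
      using bilin_moment_index[of G H y v] finV by (simp add: V_def[symmetric] bilin_def[of "{}"] y0)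
  next
    case False
    then obtain g where g: "g \<in> pverts G" by (auto simp: V_def)
    let ?P = "\<lambda>g. Pair g ` pverts H"
    have sum_P: "sum f (?P g) = (\<Sum>h\<in>pverts H. f (g, h))" for f :: "'a \<times> 'b \<Rightarrow> real" and g
      by (subst sum.reindex) (auto simp: inj_on_def)
    have sub: "?P g \<subseteq> V" if "g \<in> pverts G" for g
      using that by (auto simp: V_def)
    have "(\<Sum>q\<in>?P g. A p q) = y {p}" if pV: "p \<in> V" for p
    proof -
      obtain g' h where p: "p = (g', h)" "g' \<in> pverts G" "h \<in> pverts H"
        using pV by (auto simp: V_def)
      \<comment> \<open>All row sums are the same vector, so the fixed row \<open>g\<close> may be
        exchanged for the row of \<open>p\<close> itself, where orthogonality leaves only the
        diagonal entry.\<close>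
      have "(\<Sum>q\<in>?P g. A p q) = (\<Sum>q\<in>?P g'. A p q)"
        using g p(2) pV
        by (intro block_sums_eq[OF finV psd sub sub]) (simp_all add: sum_P row)
      also have "\<dots> = y {p}"
        using p pV by (simp add: sum_P diag_row y1)
      finally show ?thesis .
    qed
    then have "(\<Sum>p\<in>V. v {p} * y {p}) = (\<Sum>p\<in>V. v {p} * (\<Sum>q\<in>?P g. A p q))"
      by simp
    then show ?thesis
      using bordered_form_nonneg[OF finV psd sub[OF g], of "v {}" "\<lambda>p. v {p}"] finV
        bilin_moment_index[of G H y v] form
      by (simp add: V_def[symmetric] sum_P row g y0)
  qed
  then have "real_psd (moment_index G H) (moment_matrix y)"
    by (auto simp: real_psd_def moment_matrix_def Un_commute)
  then show ?thesis
    using yrow ycol y0 zero y by (auto simp: lasserre1_def of_real_psd_cone_iff V_def)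
qed

text \<open>The matrix is the block of the moment matrix on singletons. By
  \<open>moment_block_sum\<close>, summing over a row or a column first turns each double sum into a
  first-order constraint.\<close>

lemma lasserre1_imp_cone_matrix:
  fixes G :: "'a pair_pre_digraph" and H :: "'b pair_pre_digraph"
  assumes fin: "finite (pverts G)" "finite (pverts H)" and L: "lasserre1 G H y"
  shows "real_psd (pverts G \<times> pverts H) (\<lambda>p q. y {p, q})"
    and "\<And>g g'. g \<in> pverts G \<Longrightarrow> g' \<in> pverts G \<Longrightarrow>
      (\<Sum>h\<in>pverts H. \<Sum>h'\<in>pverts H. y {(g, h), (g', h')}) = 1"
    and "\<And>h h'. h \<in> pverts H \<Longrightarrow> h' \<in> pverts H \<Longrightarrow>
      (\<Sum>g\<in>pverts G. \<Sum>g'\<in>pverts G. y {(g, h), (g', h')}) = 1"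
proof -
  let ?V = "pverts G \<times> pverts H"
  have finV: "finite ?V" using fin by simp
  have psd: "real_psd (moment_index G H) (moment_matrix y)"
    using L by (simp add: lasserre1_def of_real_psd_cone_iff)
  have y0: "y {} = 1"
    and row: "\<And>g. g \<in> pverts G \<Longrightarrow> (\<Sum>h\<in>pverts H. y {(g, h)}) = 1"
    and col: "\<And>h. h \<in> pverts H \<Longrightarrow> (\<Sum>g\<in>pverts G. y {(g, h)}) = 1"
    and zero: "\<And>g g' h h'. g \<in> pverts G \<Longrightarrow> g' \<in> pverts G \<Longrightarrow> h \<in> pverts H \<Longrightarrow> h' \<in> pverts H \<Longrightarrow>
      rel G g g' \<noteq> rel H h h' \<Longrightarrow> y {(g, h), (g', h')} = 0"
    using L by (auto simp: lasserre1_def)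
  have "0 \<le> bilin ?V (\<lambda>p q. y {p, q}) u u" for u
  proof -
    \<comment> \<open>Extending \<open>u\<close> by 0 at \<open>{}\<close> kills the border
      terms.\<close>
    let ?v = "\<lambda>S. if S = {} then 0 else u (the_elem S)"
    have "0 \<le> bilin (moment_index G H) (moment_matrix y) ?v ?v"
      using psd unfolding real_psd_def by blast
    then show ?thesis
      unfolding bilin_moment_index[OF finV] by simp
  qed
  then show "real_psd ?V (\<lambda>p q. y {p, q})"
    by (simp add: real_psd_def insert_commute)
  have sum_row: "sum f (Pair g ` pverts H) = (\<Sum>h\<in>pverts H. f (g, h))"
    for f :: "'a \<times> 'b \<Rightarrow> real" and g
    by (subst sum.reindex) (auto simp: inj_on_def)
  have sum_col: "sum f ((\<lambda>g. (g, h)) ` pverts G) = (\<Sum>g\<in>pverts G. f (g, h))"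
    for f :: "'a \<times> 'b \<Rightarrow> real" and h
    by (subst sum.reindex) (auto simp: inj_on_def)
  show "(\<Sum>h\<in>pverts H. \<Sum>h'\<in>pverts H. y {(g, h), (g', h')}) = 1"
    if g: "g \<in> pverts G" "g' \<in> pverts G" for g g'
  proof -
    have "(\<Sum>p\<in>Pair g ` pverts H. y {p, q}) = y {q}" if "q \<in> ?V" for q
      using g that
      by (intro moment_block_sum[OF finV psd y0]) (auto simp: sum_row row rel_def intro!: zero split: if_splits)
    then have "(\<Sum>h\<in>pverts H. y {(g, h), (g', h')}) = y {(g', h')}" if "h' \<in> pverts H" for h'
      using g that by (simp add: sum_row)
    \<comment> \<open>After the swap the inner sum over the row of \<open>g\<close> collapses to
      \<open>y {(g', h')}\<close>, leaving the row sum of \<open>g'\<close>.\<close>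
    then show ?thesis
      using row[OF g(2)] by (subst sum.swap) simp
  qed
  show "(\<Sum>g\<in>pverts G. \<Sum>g'\<in>pverts G. y {(g, h), (g', h')}) = 1"
    if h: "h \<in> pverts H" "h' \<in> pverts H" for h h'
  proof -
    have "(\<Sum>p\<in>(\<lambda>g. (g, h)) ` pverts G. y {p, q}) = y {q}" if "q \<in> ?V" for q
      using h that
      by (intro moment_block_sum[OF finV psd y0]) (auto simp: sum_col col rel_def intro!: zero split: if_splits)
    then have "(\<Sum>g\<in>pverts G. y {(g, h), (g', h')}) = y {(g', h')}" if "g' \<in> pverts G" for g'
      using h that by (simp add: sum_col)
    then show ?thesis
      using col[OF h(2)] by (subst sum.swap) simp
  qed
qed

section \<open>Both directions for a general family of cones\<close>

text \<open>Keeping \<open>K\<close> general serves both equivalences. Besides feasibility, the link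
  between \<open>y\<close> and \<open>M\<close> is exported, so that nonnegative entries can be
  carried over to the variables.\<close>

lemma cone_isomorphic_imp_lasserre1:
  fixes G :: "'a pair_pre_digraph" and H :: "'b pair_pre_digraph"
  assumes fin: "finite (pverts G)" "finite (pverts H)"
    and iso: "cone_isomorphic K G H"
    and K: "K (pverts G \<times> pverts H) \<subseteq> psd_cone (pverts G \<times> pverts H)"
  obtains M y where "M \<in> K (pverts G \<times> pverts H)" "lasserre1 G H y" "y {} = 1"
    "\<And>p q. p \<in> pverts G \<times> pverts H \<Longrightarrow> q \<in> pverts G \<times> pverts H \<Longrightarrow> y {p, q} = Re (M p q)"
proof -
  let ?V = "pverts G \<times> pverts H"
  obtain M where M: "M \<in> K ?V"
    and row: "\<And>g g'. g \<in> pverts G \<Longrightarrow> g' \<in> pverts G \<Longrightarrow>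
      (\<Sum>h\<in>pverts H. \<Sum>h'\<in>pverts H. M (g, h) (g', h')) = 1"
    and col: "\<And>h h'. h \<in> pverts H \<Longrightarrow> h' \<in> pverts H \<Longrightarrow>
      (\<Sum>g\<in>pverts G. \<Sum>g'\<in>pverts G. M (g, h) (g', h')) = 1"
    and zero: "\<And>g g' h h'. g \<in> pverts G \<Longrightarrow> g' \<in> pverts G \<Longrightarrow> h \<in> pverts H \<Longrightarrow> h' \<in> pverts H \<Longrightarrow>
      rel G g g' \<noteq> rel H h h' \<Longrightarrow> M (g, h) (g', h') = 0"
    using iso unfolding cone_isomorphic_def by blast
  let ?A = "\<lambda>p q. Re (M p q)"
  have psd: "real_psd ?V ?A"
    using M K by (intro real_psd_Re) auto
  then obtain y where y: "y {} = 1" "\<And>p q. p \<in> ?V \<Longrightarrow> q \<in> ?V \<Longrightarrow> y {p, q} = ?A p q"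
    using pair_function_exists[of ?V ?A] unfolding real_psd_def by blast
  have "lasserre1 G H y"
  proof (rule cone_matrix_imp_lasserre1[OF fin psd])
    show "(\<Sum>h\<in>pverts H. \<Sum>h'\<in>pverts H. ?A (g, h) (g', h')) = 1"
      if "g \<in> pverts G" "g' \<in> pverts G" for g g'
      using arg_cong[OF row[OF that], of Re] by simp
    show "(\<Sum>g\<in>pverts G. \<Sum>g'\<in>pverts G. ?A (g, h) (g', h')) = 1"
      if "h \<in> pverts H" "h' \<in> pverts H" for h h'
      using arg_cong[OF col[OF that], of Re] by simp
  qed (use zero y in auto)
  then show ?thesis
    using M y that by blast
qed

text \<open>The linear constraints hold for every \<open>K\<close>; only membership in the cone has
  to be supplied separately.\<close>

lemma lasserre1_imp_cone_isomorphic: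
  fixes G :: "'a pair_pre_digraph" and H :: "'b pair_pre_digraph"
  assumes fin: "finite (pverts G)" "finite (pverts H)" and L: "lasserre1 G H y"
    and K: "(\<lambda>p q. complex_of_real (y {p, q})) \<in> K (pverts G \<times> pverts H)"
  shows "cone_isomorphic K G H"
  unfolding cone_isomorphic_def
proof (intro bexI[OF _ K] conjI ballI impI)
  show "(\<Sum>h\<in>pverts H. \<Sum>h'\<in>pverts H. complex_of_real (y {(g, h), (g', h')})) = 1"
    if "g \<in> pverts G" "g' \<in> pverts G" for g g'
    using arg_cong[OF lasserre1_imp_cone_matrix(2)[OF fin L that], of complex_of_real] by simp
  show "(\<Sum>g\<in>pverts G. \<Sum>g'\<in>pverts G. complex_of_real (y {(g, h), (g', h')})) = 1"
    if "h \<in> pverts H" "h' \<in> pverts H" for h h'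
    using arg_cong[OF lasserre1_imp_cone_matrix(3)[OF fin L that], of complex_of_real] by simp
qed (use L in \<open>simp add: lasserre1_def\<close>)

theorem lemma9p1:
  fixes G :: "'a pair_pre_digraph" and H :: "'b pair_pre_digraph"
  assumes "pair_graph G" and "pair_graph H"
  shows "(cone_isomorphic psd_cone G H \<longleftrightarrow> (\<exists>y. lasserre1 G H y)) \<and>
         (cone_isomorphic dnn_cone G H \<longleftrightarrow> (\<exists>y. lasserre1 G H y \<and> nonneg_variables G H y))"
proof -
  interpret G: pair_graph G by fact
  interpret H: pair_graph H by fact
  let ?V = "pverts G \<times> pverts H"
  note fin = G.pair_finite_verts H.pair_finite_verts
  have psd: "(\<lambda>p q. complex_of_real (y {p, q})) \<in> psd_cone ?V" if "lasserre1 G H y" for y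
    using lasserre1_imp_cone_matrix(1)[OF fin that] by (simp add: of_real_psd_cone_iff)
  have "cone_isomorphic psd_cone G H \<longleftrightarrow> (\<exists>y. lasserre1 G H y)"
  proof
    show "\<exists>y. lasserre1 G H y" if "cone_isomorphic psd_cone G H"
      by (rule cone_isomorphic_imp_lasserre1[OF fin that order_refl]) (rule exI)
    show "cone_isomorphic psd_cone G H" if "\<exists>y. lasserre1 G H y"
      using that
      by (elim exE) (rule lasserre1_imp_cone_isomorphic[where K = psd_cone, OF fin _ psd])
  qed
  moreover have "\<exists>y. lasserre1 G H y \<and> nonneg_variables G H y"
    if iso: "cone_isomorphic dnn_cone G H"
  proof -
    have sub: "dnn_cone ?V \<subseteq> psd_cone ?V"
      by (auto simp: dnn_cone_def)
    obtain M y where M: "M \<in> dnn_cone ?V" and L: "lasserre1 G H y" and y0: "y {} = 1"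
      and y: "\<And>p q. p \<in> ?V \<Longrightarrow> q \<in> ?V \<Longrightarrow> y {p, q} = Re (M p q)"
      by (rule cone_isomorphic_imp_lasserre1[OF fin iso sub]) (rule that)
    have nonneg: "0 \<le> y {p, q}" if "p \<in> ?V" "q \<in> ?V" for p q
    proof -
      have "M p q \<in> \<real>\<^sub>\<ge>\<^sub>0" using M that unfolding dnn_cone_def by blast
      then show ?thesis
        using y[OF that] by (simp add: nonneg_Reals_Re)
    qed
    have "0 \<le> y S" if S: "S \<subseteq> ?V" "card S \<le> 2" for S
    proof -
      have "finite S" using S fin finite_subset by blast
      moreover have "card S = 0 \<or> card S = 1 \<or> card S = 2" using S(2) by linarith
      \<comment> \<open>Nonempty index sets are pairs, a singleton being \<open>{p, p}\<close>, so
        \<open>nonneg\<close> covers them; \<open>y0\<close> settles the empty set.\<close>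
      ultimately consider "S = {}" | p where "S = {p}" | p q where "S = {p, q}"
        by (metis card_0_eq card_1_singletonE card_2_iff)
      then show ?thesis
      proof cases
        case 2
        then show ?thesis using nonneg[of p p] S(1) by auto
      qed (use nonneg S(1) y0 in auto)
    qed
    with L show ?thesis by (auto simp: nonneg_variables_def)
  qed
  moreover have "cone_isomorphic dnn_cone G H"
    if L: "lasserre1 G H y" and "nonneg_variables G H y" for y
  proof (rule lasserre1_imp_cone_isomorphic[OF fin L])
    \<comment> \<open>The set \<open>{p, q}\<close> has at most two elements, also when
      \<open>p = q\<close>, so the entry is one of the constrained variables.\<close>
    have "0 \<le> y {p, q}" if "p \<in> ?V" "q \<in> ?V" for p q
      using \<open>nonneg_variables G H y\<close> that
      by (auto simp: nonneg_variables_def card_insert_if)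
    then show "(\<lambda>p q. complex_of_real (y {p, q})) \<in> dnn_cone ?V"
      using psd[OF L] by (auto simp: dnn_cone_def)
  qed
  ultimately show ?thesis by blast
qed

end
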